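(* For $0\le\delta\le1$ let $f_\delta=1_{\{0\}}+\delta\,1_{\{1\}}$, a function on $\mathbb{Z}$. Then $\gamma(f_\delta)=1+\delta$, and more generally for $1<p<\infty$ and $1/p+1/q=1$, \[ \gamma_p(f_\delta)\ge\frac{p^{1/p}q^{1/q}}{2}(1+\delta). \]
   Context: For nonnegative functions $f,g$ on $\mathbb{Z}$, $(f\star g)(x)=\max_t f(t)g(x-t)$ (max-convolution). For nonnegative $f\in\ell^1(\mathbb{Z})$, $\gamma_p(f)=\inf_{g,h}\frac{\|f\star g\star h\|_1}{\|g\|_p\|h\|_q}$, the infimum over nonzero nonnegative $g,h\in\ell^1(\mathbb{Z})$, and $\gamma=\gamma_2$. *)

theory Defs
  imports "HOL-Analysis.Analysis"
begin

definition maxconv :: "(int \<Rightarrow> real) \<Rightarrow> (int \<Rightarrow> real) \<Rightarrow> int \<Rightarrow> real" where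
  "maxconv f g x = (SUP t. f t * g (x - t))"

text \<open>The l^p norm (for summable |g|^p).\<close>
definition lp_norm :: "real \<Rightarrow> (int \<Rightarrow> real) \<Rightarrow> real" where
  "lp_norm p g = (\<Sum>\<^sub>\<infinity>x. \<bar>g x\<bar> powr p) powr (1 / p)"

definition nonneg_l1 :: "(int \<Rightarrow> real) \<Rightarrow> bool" where
  "nonneg_l1 g \<longleftrightarrow> (\<forall>x. 0 \<le> g x) \<and> g summable_on UNIV \<and> g \<noteq> (\<lambda>_. 0)"

text \<open>gamma_p(f), q the conjugate exponent p/(p-1).  Pairs for which f*g*h is not
  summable give ratio +infinity and therefore do not affect the infimum.\<close>
definition gamma_p :: "real \<Rightarrow> (int \<Rightarrow> real) \<Rightarrow> real" where
  "gamma_p p f = Inf {(\<Sum>\<^sub>\<infinity>x. maxconv (maxconv f g) h x) / (lp_norm p g * lp_norm (p / (p - 1)) h)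
      | g h. nonneg_l1 g \<and> nonneg_l1 h \<and> maxconv (maxconv f g) h summable_on UNIV}"

definition gamma :: "(int \<Rightarrow> real) \<Rightarrow> real" where
  "gamma f = gamma_p 2 f"

end

theory Submission
  imports Defs
begin

text \<open>
  Extend a sequence \<open>a\<close> to the real line by \<open>a(n + u) = a(n) \<delta>^u\<close> for \<open>0 \<le> u < 1\<close>. If two
  fractional parts add up to at least 1, the carry costs exactly the factor \<open>\<delta>\<close> that \<open>f\<close> attaches
  to the shift by 1, so the sup-convolution of the extensions of \<open>g\<close> and \<open>h\<close> is dominated by the
  extension of \<open>f \<star> g \<star> h\<close>. The Prekopa-Leindler inequality on the line has the constant
  \<open>p^(1/p) q^(1/q)\<close>, and the extension multiplies \<open>\<parallel>a\<parallel>_r\<close> by \<open>m(\<delta>^r)^(1/r)\<close>, where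
  \<open>m(\<delta>)\<close> is the integral of \<open>\<delta>^u\<close> over the unit interval. Hoelder's inequality gives
  \<open>m(\<delta>^p)^(1/p) m(\<delta>^q)^(1/q) \<ge> m(\<delta>^2)\<close>, and \<open>m(\<delta>^2) = (1 + \<delta>)/2 m(\<delta>)\<close>. Equality for
  \<open>p = 2\<close> is attained when \<open>g\<close> and \<open>h\<close> are the indicator of \<open>{0}\<close>.
\<close>

section \<open>The Brunn-Minkowski inequality on the line\<close>

lemma emeasure_lborel_inner_regular:
  fixes A :: "'a::euclidean_space set"
  assumes "A \<in> sets borel"
  shows "emeasure lborel A = (SUP K\<in>{K. K \<subseteq> A \<and> compact K}. emeasure lborel K)"
proof (rule antisym)
  let ?M = "\<lambda>n. density lborel (indicator (cball (0::'a) (real n)))"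
  have truncate: "emeasure (?M n) S = emeasure lborel (cball 0 (real n) \<inter> S)"
    if "S \<in> sets borel" for n and S :: "'a set"
    using that by (intro emeasure_restricted) auto
  have cover: "A = (\<Union>n. cball 0 (real n) \<inter> A)"
    by (auto simp: real_arch_simple)
  have "emeasure lborel A = (SUP n. emeasure lborel (cball 0 (real n) \<inter> A))"
    using assms by (subst cover, intro SUP_emeasure_incseq[symmetric]) (auto simp: incseq_def)
  also have "\<dots> \<le> (SUP K\<in>{K. K \<subseteq> A \<and> compact K}. emeasure lborel K)"
  proof (rule SUP_least)
    fix n
    have "emeasure lborel (cball 0 (real n) \<inter> A)
        = (SUP K\<in>{K. K \<subseteq> A \<and> compact K}. emeasure (?M n) K)"
    proof (subst inner_regular[symmetric])
      show "emeasure (?M n) (space (?M n)) \<noteq> \<infinity>"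
        using emeasure_bounded_finite[OF bounded_cball[of "0::'a" "real n"]] by (simp add: truncate)
    qed (use assms truncate in auto)
    also have "\<dots> \<le> (SUP K\<in>{K. K \<subseteq> A \<and> compact K}. emeasure lborel K)"
    proof (rule SUP_subset_mono[OF order_refl])
      fix K assume "K \<in> {K. K \<subseteq> A \<and> compact K}"
      then show "emeasure (?M n) K \<le> emeasure lborel K"
        by (simp add: truncate borel_compact emeasure_mono)
    qed
    finally show "emeasure lborel (cball 0 (real n) \<inter> A) \<le> \<dots>" .
  qed
  finally show "emeasure lborel A \<le> \<dots>" .
next
  show "(SUP K\<in>{K. K \<subseteq> A \<and> compact K}. emeasure lborel K) \<le> emeasure lborel A"
    using assms by (intro SUP_least emeasure_mono) auto
qed

lemma emeasure_lborel_vimage_plus: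
  fixes c :: "'a::euclidean_space"
  assumes "S \<in> sets borel"
  shows "emeasure lborel ((+) c -` S) = emeasure lborel S"
  using assms by (subst (2) lborel_distr_plus[of c, symmetric]) (simp add: emeasure_distr)

lemma brunn_minkowski_real_compact:
  fixes A B C :: "real set"
  assumes "compact A" "A \<noteq> {}" "compact B" "B \<noteq> {}" "C \<in> sets borel"
    and sum_mem: "\<And>x y. x \<in> A \<Longrightarrow> y \<in> B \<Longrightarrow> x + y \<in> C"
  shows "emeasure lborel A + emeasure lborel B \<le> emeasure lborel C"
proof -
  obtain a where a: "a \<in> A" "\<And>x. x \<in> A \<Longrightarrow> x \<le> a"
    using compact_attains_sup assms by metis
  obtain b where b: "b \<in> B" "\<And>y. y \<in> B \<Longrightarrow> b \<le> y"
    using compact_attains_inf assms by metis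
  \<comment> \<open>The translates \<open>A + b\<close> and \<open>a + B\<close> lie in \<open>C\<close> and meet only in \<open>a + b\<close>.\<close>
  define A' where "A' = (+) (- b) -` A"
  define B' where "B' = (+) (- a) -` (B - {b})"
  have [measurable]: "A \<in> sets borel" "B - {b} \<in> sets borel" "C \<in> sets borel"
    using assms by (auto intro: borel_compact)
  have [measurable]: "A' \<in> sets borel" "B' \<in> sets borel"
    using measurable_sets[of "(+) (- b)" borel borel A]
      measurable_sets[of "(+) (- a)" borel borel "B - {b}"]
    by (simp_all add: A'_def B'_def)
  have "A' \<inter> B' = {}"
    using a(2) b(2) by (fastforce simp: A'_def B'_def)
  have "A' \<union> B' \<subseteq> C"
    using sum_mem[OF _ b(1)] sum_mem[OF a(1)] by (force simp: A'_def B'_def)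
  have "emeasure lborel B = emeasure lborel (B - {b})"
    using assms by (intro emeasure_Diff_null_set[symmetric]) (auto intro: borel_compact)
  then have "emeasure lborel A + emeasure lborel B = emeasure lborel A' + emeasure lborel B'"
    by (simp add: A'_def B'_def emeasure_lborel_vimage_plus)
  also have "\<dots> = emeasure lborel (A' \<union> B')"
    using \<open>A' \<inter> B' = {}\<close> by (intro plus_emeasure) auto
  also have "\<dots> \<le> emeasure lborel C"
    using \<open>A' \<union> B' \<subseteq> C\<close> by (intro emeasure_mono) auto
  finally show ?thesis .
qed

lemma brunn_minkowski_real:
  fixes A B C :: "real set"
  assumes A: "A \<in> sets borel" "A \<noteq> {}" and B: "B \<in> sets borel" "B \<noteq> {}" and C: "C \<in> sets borel"
    and sum_mem: "\<And>x y. x \<in> A \<Longrightarrow> y \<in> B \<Longrightarrow> x + y \<in> C"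
  shows "emeasure lborel A + emeasure lborel B \<le> emeasure lborel C"
proof -
  obtain a b where "a \<in> A" "b \<in> B" using A B by auto
  have "emeasure lborel K + emeasure lborel L \<le> emeasure lborel C"
    if "K \<subseteq> A" "compact K" "L \<subseteq> B" "compact L" for K L
  proof -
    have "emeasure lborel K + emeasure lborel L
        \<le> emeasure lborel (insert a K) + emeasure lborel (insert b L)"
      using that by (intro add_mono emeasure_mono) (auto intro: borel_compact)
    also have "\<dots> \<le> emeasure lborel C"
      using that \<open>a \<in> A\<close> \<open>b \<in> B\<close> C
      by (intro brunn_minkowski_real_compact) (auto intro: sum_mem)
    finally show ?thesis .
  qed
  then have "(SUP K\<in>{K. K \<subseteq> A \<and> compact K}. SUP L\<in>{L. L \<subseteq> B \<and> compact L}.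
      emeasure lborel K + emeasure lborel L) \<le> emeasure lborel C"
    by (auto intro!: SUP_least)
  moreover have "{K. K \<subseteq> S \<and> compact K} \<noteq> {}" for S :: "real set"
    using compact_empty by blast
  ultimately show ?thesis
    by (simp only: emeasure_lborel_inner_regular A(1) B(1) ennreal_SUP_add_left[symmetric]
        ennreal_SUP_add_right[symmetric] not_False_eq_True)
qed

lemma borel_measurable_emeasure_superlevel [measurable]:
  fixes f :: "real \<Rightarrow> ennreal"
  assumes [measurable]: "f \<in> borel_measurable borel"
  shows "(\<lambda>t::real. emeasure lborel {x. ennreal t < f x}) \<in> borel_measurable borel"
proof -
  have "(\<lambda>t::real. emeasure lborel {x \<in> space lborel. ennreal t < f x}) \<in> borel_measurable borel"
    by measurable
  then show ?thesis by simp
qed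

lemma emeasure_lborel_atLeast [simp]: "emeasure lborel {a::real..} = \<infinity>"
proof -
  have "of_nat n \<le> emeasure lborel {a..}" for n
    using emeasure_mono[of "{a..a + real n}" "{a..}" lborel]
    by (simp add: ennreal_of_nat_eq_real_of_nat)
  then have "(SUP n. of_nat n :: ennreal) \<le> emeasure lborel {a..}"
    by (intro SUP_least)
  then show ?thesis
    by (simp add: ennreal_SUP_of_nat_eq_top top_unique)
qed

lemma nn_integral_layer_cake:
  fixes f :: "real \<Rightarrow> ennreal"
  assumes [measurable]: "f \<in> borel_measurable borel"
  shows "(\<integral>\<^sup>+x. f x \<partial>lborel)
    = (\<integral>\<^sup>+t. emeasure lborel {x. ennreal t < f x} * indicator {0..} t \<partial>lborel)"
proof -
  let ?below = "\<lambda>x t. indicator {t. 0 \<le> t \<and> ennreal t < f x} t :: ennreal"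
  have "f x = (\<integral>\<^sup>+t. ?below x t \<partial>lborel)" for x
  proof (cases "f x")
    case (real r)
    then have "{t. 0 \<le> t \<and> ennreal t < f x} = {0..<r}"
      by (auto simp: ennreal_less_iff)
    then show ?thesis using real by simp
  next
    case top
    then have "{t. 0 \<le> t \<and> ennreal t < f x} = {0..}" by auto
    then show ?thesis using top by (simp del: top_greatest)
  qed
  then have "(\<integral>\<^sup>+x. f x \<partial>lborel) = (\<integral>\<^sup>+x. \<integral>\<^sup>+t. ?below x t \<partial>lborel \<partial>lborel)"
    by simp
  also have "\<dots> = (\<integral>\<^sup>+t. \<integral>\<^sup>+x. ?below x t \<partial>lborel \<partial>lborel)"
    by (rule lborel_pair.Fubini') measurable
  also have "\<dots> = (\<integral>\<^sup>+t. emeasure lborel {x. ennreal t < f x} * indicator {0..} t \<partial>lborel)"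
  proof (rule nn_integral_cong)
    fix t
    have "(\<integral>\<^sup>+x. ?below x t \<partial>lborel)
        = (\<integral>\<^sup>+x. indicator {x. ennreal t < f x} x * indicator {0..} t \<partial>lborel)"
      by (intro nn_integral_cong) (auto split: split_indicator)
    then show "(\<integral>\<^sup>+x. ?below x t \<partial>lborel)
        = emeasure lborel {x. ennreal t < f x} * indicator {0..} t"
      by (simp add: nn_integral_multc)
  qed
  finally show ?thesis .
qed

lemma brunn_minkowski_superlevel:
  fixes f g w :: "real \<Rightarrow> ennreal"
  assumes [measurable]: "f \<in> borel_measurable borel" "g \<in> borel_measurable borel"
      "w \<in> borel_measurable borel"
    and same_SUP: "(SUP x. f x) = (SUP y. g y)"
    and min_le: "\<And>x y. min (f x) (g y) \<le> w (x + y)"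
  shows "emeasure lborel {x. t < f x} + emeasure lborel {y. t < g y} \<le> emeasure lborel {z. t < w z}"
proof -
  have "(\<exists>x. t < f x) \<longleftrightarrow> t < (SUP x. f x)" by (simp add: less_SUP_iff)
  also have "\<dots> \<longleftrightarrow> (\<exists>y. t < g y)" by (simp add: same_SUP less_SUP_iff)
  finally have nonempty_iff: "(\<exists>x. t < f x) \<longleftrightarrow> (\<exists>y. t < g y)" .
  show ?thesis
  proof (cases "\<exists>x. t < f x")
    case True
    show ?thesis
    proof (rule brunn_minkowski_real)
      show "{x. t < f x} \<noteq> {}" "{y. t < g y} \<noteq> {}"
        using True nonempty_iff by auto
      fix x y assume "x \<in> {x. t < f x}" "y \<in> {y. t < g y}"
      then have "t < min (f x) (g y)" by simp
      also have "\<dots> \<le> w (x + y)" by (rule min_le)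
      finally show "x + y \<in> {z. t < w z}" by simp
    qed measurable
  next
    case False
    then have "{x. t < f x} = {}" "{y. t < g y} = {}"
      using nonempty_iff by auto
    then show ?thesis by simp
  qed
qed

lemma brunn_minkowski_nn_integral:
  fixes f g w :: "real \<Rightarrow> ennreal"
  assumes [measurable]: "f \<in> borel_measurable borel" "g \<in> borel_measurable borel"
      "w \<in> borel_measurable borel"
    and "(SUP x. f x) = (SUP y. g y)" "\<And>x y. min (f x) (g y) \<le> w (x + y)"
  shows "(\<integral>\<^sup>+x. f x \<partial>lborel) + (\<integral>\<^sup>+y. g y \<partial>lborel) \<le> (\<integral>\<^sup>+z. w z \<partial>lborel)"
proof -
  have "(\<integral>\<^sup>+x. f x \<partial>lborel) + (\<integral>\<^sup>+y. g y \<partial>lborel)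
      = (\<integral>\<^sup>+t. emeasure lborel {x. ennreal t < f x} * indicator {0..} t
          + emeasure lborel {y. ennreal t < g y} * indicator {0..} t \<partial>lborel)"
    by (subst (1 2) nn_integral_layer_cake) (simp_all add: nn_integral_add)
  also have "\<dots> \<le> (\<integral>\<^sup>+t. emeasure lborel {z. ennreal t < w z} * indicator {0..} t \<partial>lborel)"
    using brunn_minkowski_superlevel[OF assms]
    by (intro nn_integral_mono) (simp split: split_indicator)
  also have "\<dots> = (\<integral>\<^sup>+z. w z \<partial>lborel)"
    by (rule nn_integral_layer_cake[symmetric]) fact
  finally show ?thesis .
qed

section \<open>The Prekopa-Leindler inequality on the line\<close>

definition nonneg_bounded :: "('a \<Rightarrow> real) \<Rightarrow> bool" where
  "nonneg_bounded f \<longleftrightarrow> (\<forall>x. 0 \<le> f x) \<and> bdd_above (range f)"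

lemma nonneg_boundedI:
  assumes "\<And>x. 0 \<le> f x" "\<And>x. f x \<le> M"
  shows "nonneg_bounded f"
  using assms by (auto simp: nonneg_bounded_def intro!: bdd_aboveI2[where M = M])

lemma SUP_ennreal_powr_normalised:
  fixes \<phi> :: "'a \<Rightarrow> real"
  assumes "nonneg_bounded \<phi>" "0 < p"
  defines "S \<equiv> SUP x. \<phi> x"
  assumes "0 < S"
  shows "(SUP x. ennreal ((\<phi> x / S) powr p)) = 1"
proof (rule SUP_eqI)
  have nonneg: "\<And>x. 0 \<le> \<phi> x" and bdd: "bdd_above (range \<phi>)"
    using assms(1) by (simp_all add: nonneg_bounded_def)
  show "ennreal ((\<phi> x / S) powr p) \<le> 1" for x
  proof -
    have "\<phi> x / S \<le> 1"
      using cSUP_upper[OF UNIV_I bdd, of x] \<open>0 < S\<close> by (simp add: S_def)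
    then show ?thesis
      using nonneg \<open>0 < S\<close> \<open>0 < p\<close> powr_mono2[of p "\<phi> x / S" 1] by (simp add: ennreal_le_1)
  qed
  fix b :: ennreal
  assume upper: "\<And>x. x \<in> UNIV \<Longrightarrow> ennreal ((\<phi> x / S) powr p) \<le> b"
  show "1 \<le> b"
  proof (rule ccontr)
    assume "\<not> 1 \<le> b"
    then obtain t where t: "b = ennreal t" "0 \<le> t" "t < 1"
      by (cases b) (auto simp: not_le)
    then have "t powr (1 / p) * S < S"
      using \<open>0 < p\<close> \<open>0 < S\<close> powr_less_mono2[of "1 / p" t 1] by simp
    then obtain x where "t powr (1 / p) * S < \<phi> x"
      using bdd by (auto simp: S_def less_cSUP_iff)
    then have "t powr (1 / p) < \<phi> x / S"
      using \<open>0 < S\<close> by (simp add: field_simps)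
    then have "(t powr (1 / p)) powr p < (\<phi> x / S) powr p"
      using \<open>0 < p\<close> by (intro powr_less_mono2) auto
    then have "t < (\<phi> x / S) powr p"
      using \<open>0 < p\<close> t by (simp add: powr_powr)
    then show False
      using upper[of x] t by simp
  qed
qed

locale conjugate_exponents =
  fixes p q :: real
  assumes p_pos: "0 < p" and q_pos: "0 < q" and inverse_sum: "1 / p + 1 / q = 1"
begin

lemma p_gt_1: "1 < p" and q_gt_1: "1 < q"
proof -
  have "0 < 1 / p" "0 < 1 / q" using p_pos q_pos by simp_all
  then have "1 / p < 1" "1 / q < 1" using inverse_sum by linarith+
  then show "1 < p" "1 < q" using p_pos q_pos by (simp_all add: field_simps)
qed

lemma conjugate_eq: "p / (p - 1) = q"
  using inverse_sum p_gt_1 q_pos by (simp add: field_simps)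

lemma weighted_young:
  assumes "0 \<le> x" "0 \<le> y"
  shows "p powr (1 / p) * q powr (1 / q) * (x * y) \<le> x powr p + y powr q"
proof -
  have "(p powr (1 / p) * x) * (q powr (1 / q) * y)
      \<le> (p powr (1 / p) * x) powr p / p + (q powr (1 / q) * y) powr q / q"
    using assms p_gt_1 q_gt_1 inverse_sum by (intro Youngs_inequality) auto
  then show ?thesis
    using assms p_pos q_pos by (simp add: powr_mult powr_powr mult_ac)
qed

lemma min_le_weighted_geometric_mean:
  fixes s t :: real
  assumes "0 \<le> s" "0 \<le> t"
  shows "min s t \<le> s powr (1 / p) * t powr (1 / q)"
proof -
  have "min s t = min s t powr (1 / p) * min s t powr (1 / q)"
    using assms inverse_sum by (simp flip: powr_add)
  also have "\<dots> \<le> s powr (1 / p) * t powr (1 / q)"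
    using assms p_pos q_pos by (intro mult_mono powr_mono2) auto
  finally show ?thesis .
qed

lemma integral_mult_le_of_integral_powr_pos:
  fixes u v :: "'a \<Rightarrow> real"
  assumes nonneg: "\<And>x. 0 \<le> u x" "\<And>x. 0 \<le> v x"
    and integrable: "integrable M (\<lambda>x. u x powr p)" "integrable M (\<lambda>x. v x powr q)"
      "integrable M (\<lambda>x. u x * v x)"
    and pos: "0 < (LINT x|M. u x powr p)" "0 < (LINT x|M. v x powr q)"
  shows "(LINT x|M. u x * v x)
    \<le> (LINT x|M. u x powr p) powr (1 / p) * (LINT x|M. v x powr q) powr (1 / q)"
proof -
  define U where "U = (LINT x|M. u x powr p)"
  define V where "V = (LINT x|M. v x powr q)"
  let ?norms = "U powr (1 / p) * V powr (1 / q)"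
  have "0 < U" "0 < V" using pos by (auto simp: U_def V_def)
  have "(LINT x|M. u x * v x) / ?norms = (LINT x|M. u x * v x / ?norms)"
    by simp
  also have "\<dots> \<le> (LINT x|M. u x powr p / U / p + v x powr q / V / q)"
  proof (rule integral_mono)
    fix x
    have "u x * v x / ?norms = u x / U powr (1 / p) * (v x / V powr (1 / q))" by simp
    also have "\<dots> \<le> (u x / U powr (1 / p)) powr p / p + (v x / V powr (1 / q)) powr q / q"
      using nonneg p_gt_1 q_gt_1 inverse_sum by (intro Youngs_inequality) auto
    also have "\<dots> = u x powr p / U / p + v x powr q / V / q"
      using nonneg \<open>0 < U\<close> \<open>0 < V\<close> p_pos q_pos by (simp add: powr_divide powr_powr)
    finally show "u x * v x / ?norms \<le> u x powr p / U / p + v x powr q / V / q" .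
  qed (use integrable in auto)
  also have "\<dots> = U / U / p + V / V / q"
    using integrable by (simp add: U_def V_def)
  also have "\<dots> = 1"
    using \<open>0 < U\<close> \<open>0 < V\<close> inverse_sum by simp
  finally show ?thesis
    using \<open>0 < U\<close> \<open>0 < V\<close> by (simp add: divide_le_eq U_def V_def)
qed

lemma integral_holder:
  fixes u v :: "'a \<Rightarrow> real"
  assumes nonneg: "\<And>x. 0 \<le> u x" "\<And>x. 0 \<le> v x"
    and integrable: "integrable M (\<lambda>x. u x powr p)" "integrable M (\<lambda>x. v x powr q)"
  shows "(LINT x|M. u x * v x)
    \<le> (LINT x|M. u x powr p) powr (1 / p) * (LINT x|M. v x powr q) powr (1 / q)"
proof -
  have integral_mult_0: "(LINT x|M. u x * v x) = 0"
    if "(LINT x|M. u x powr p) = 0 \<or> (LINT x|M. v x powr q) = 0"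
  proof -
    have "(AE x in M. u x powr p = 0) \<or> (AE x in M. v x powr q = 0)"
      using that integrable by (auto simp: integral_nonneg_eq_0_iff_AE)
    then have "AE x in M. u x * v x = 0" by (auto elim: eventually_mono)
    then show ?thesis by (rule integral_eq_zero_AE)
  qed
  show ?thesis
  proof (cases "integrable M (\<lambda>x. u x * v x)
      \<and> (LINT x|M. u x powr p) \<noteq> 0 \<and> (LINT x|M. v x powr q) \<noteq> 0")
    case True
    then show ?thesis
      using assms by (intro integral_mult_le_of_integral_powr_pos) (auto simp: order_less_le)
  next
    case False
    then have "(LINT x|M. u x * v x) = 0"
      using integral_mult_0 not_integrable_integral_eq by blast
    then show ?thesis by simp
  qed
qed

lemma prekopa_leindler_real_additive:
  fixes \<phi> \<psi> \<omega> :: "real \<Rightarrow> real"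
  assumes \<phi>: "nonneg_bounded \<phi>" "integrable lborel (\<lambda>x. \<phi> x powr p)"
    and \<psi>: "nonneg_bounded \<psi>" "integrable lborel (\<lambda>y. \<psi> y powr q)"
    and \<omega>: "\<And>z. 0 \<le> \<omega> z" "integrable lborel \<omega>"
    and mult_le: "\<And>x y. \<phi> x * \<psi> y \<le> \<omega> (x + y)"
    and pos: "0 < (SUP x. \<phi> x)" "0 < (SUP y. \<psi> y)"
  defines "A \<equiv> SUP x. \<phi> x" and "B \<equiv> SUP y. \<psi> y"
  shows "(LBINT x. \<phi> x powr p) / A powr p + (LBINT y. \<psi> y powr q) / B powr q
    \<le> (LBINT z. \<omega> z) / (A * B)"
proof -
  have scales_pos: "0 < A" "0 < B" using pos by (simp_all add: A_def B_def)
  have \<phi>_nonneg: "0 \<le> \<phi> x" and \<psi>_nonneg: "0 \<le> \<psi> x" for x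
    using \<phi>(1) \<psi>(1) by (simp_all add: nonneg_bounded_def)
  define f where "f x = (\<phi> x / A) powr p" for x
  define g where "g y = (\<psi> y / B) powr q" for y
  define w where "w = (\<lambda>z. \<omega> z / (A * B))"
  have f_eq: "f = (\<lambda>x. \<phi> x powr p / A powr p)" and g_eq: "g = (\<lambda>y. \<psi> y powr q / B powr q)"
    using scales_pos \<phi>_nonneg \<psi>_nonneg by (auto simp: f_def g_def powr_divide)
  have integrable: "integrable lborel f" "integrable lborel g" "integrable lborel w"
    using \<phi>(2) \<psi>(2) \<omega>(2) by (simp_all add: f_eq g_eq w_def)
  have nonneg: "0 \<le> f x" "0 \<le> g x" "0 \<le> w x" for x
    using scales_pos \<omega>(1) by (simp_all add: f_def g_def w_def)
  have "(\<integral>\<^sup>+x. ennreal (f x) \<partial>lborel) + (\<integral>\<^sup>+y. ennreal (g y) \<partial>lborel)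
      \<le> (\<integral>\<^sup>+z. ennreal (w z) \<partial>lborel)"
  proof (rule brunn_minkowski_nn_integral)
    show "(SUP x. ennreal (f x)) = (SUP y. ennreal (g y))"
      using SUP_ennreal_powr_normalised[OF \<phi>(1) p_pos pos(1)]
        SUP_ennreal_powr_normalised[OF \<psi>(1) q_pos pos(2)]
      by (simp add: f_def g_def A_def B_def)
    fix x y
    have "min (f x) (g y) \<le> f x powr (1 / p) * g y powr (1 / q)"
      by (intro min_le_weighted_geometric_mean nonneg)
    also have "\<dots> = \<phi> x * \<psi> y / (A * B)"
      using scales_pos \<phi>_nonneg \<psi>_nonneg p_pos q_pos by (simp add: f_def g_def powr_powr)
    also have "\<dots> \<le> w (x + y)"
      unfolding w_def using scales_pos mult_le by (intro divide_right_mono) auto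
    finally show "min (ennreal (f x)) (ennreal (g y)) \<le> ennreal (w (x + y))"
      using nonneg by (simp add: ennreal_leI min_ennreal)
  qed (use integrable in measurable)
  then have "(LBINT x. f x) + (LBINT y. g y) \<le> (LBINT z. w z)"
    using integrable nonneg by (simp add: nn_integral_eq_integral flip: ennreal_plus)
  then show ?thesis
    by (simp add: f_eq g_eq w_def)
qed

theorem prekopa_leindler_real:
  fixes \<phi> \<psi> \<omega> :: "real \<Rightarrow> real"
  assumes \<phi>: "nonneg_bounded \<phi>" "integrable lborel (\<lambda>x. \<phi> x powr p)"
    and \<psi>: "nonneg_bounded \<psi>" "integrable lborel (\<lambda>y. \<psi> y powr q)"
    and "integrable lborel \<omega>" and mult_le: "\<And>x y. \<phi> x * \<psi> y \<le> \<omega> (x + y)"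
  shows "p powr (1 / p) * q powr (1 / q)
      * ((LBINT x. \<phi> x powr p) powr (1 / p) * (LBINT y. \<psi> y powr q) powr (1 / q)) \<le> (LBINT z. \<omega> z)"
proof -
  define A where "A = (SUP x. \<phi> x)"
  define B where "B = (SUP y. \<psi> y)"
  define a where "a = (LBINT x. \<phi> x powr p)"
  define b where "b = (LBINT y. \<psi> y powr q)"
  have \<phi>_bounds: "0 \<le> \<phi> x" "\<phi> x \<le> A" and \<psi>_bounds: "0 \<le> \<psi> x" "\<psi> x \<le> B" for x
    using \<phi>(1) \<psi>(1) by (auto simp: nonneg_bounded_def A_def B_def intro: cSUP_upper)
  have \<omega>_nonneg: "0 \<le> \<omega> z" for z
    using order_trans[OF mult_nonneg_nonneg mult_le[of z 0]] \<phi>_bounds \<psi>_bounds by simp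
  show ?thesis
  proof (cases "0 < A \<and> 0 < B")
    case False
    then have "(\<forall>x. \<phi> x = 0) \<or> (\<forall>y. \<psi> y = 0)"
      using \<phi>_bounds \<psi>_bounds by (metis antisym not_less order_trans)
    then show ?thesis by (auto simp: \<omega>_nonneg)
  next
    case True
    have "0 \<le> a" "0 \<le> b" by (simp_all add: a_def b_def)
    have "p powr (1 / p) * q powr (1 / q) * (a powr (1 / p) / A * (b powr (1 / q) / B))
        \<le> (a powr (1 / p) / A) powr p + (b powr (1 / q) / B) powr q"
      using True by (intro weighted_young) auto
    also have "\<dots> = a / A powr p + b / B powr q"
      using True p_pos q_pos \<open>0 \<le> a\<close> \<open>0 \<le> b\<close> by (simp add: powr_divide powr_powr)
    also have "\<dots> \<le> (LBINT z. \<omega> z) / (A * B)"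
      using assms True \<omega>_nonneg unfolding a_def b_def A_def B_def
      by (intro prekopa_leindler_real_additive) auto
    finally show ?thesis
      using True by (simp add: divide_le_cancel a_def b_def)
  qed
qed

end

section \<open>Geometric extensions of sequences\<close>

definition geometric_extension :: "real \<Rightarrow> (int \<Rightarrow> real) \<Rightarrow> real \<Rightarrow> real" where
  "geometric_extension \<delta> a x = a \<lfloor>x\<rfloor> * \<delta> powr frac x"

definition geometric_mass :: "real \<Rightarrow> real" where
  "geometric_mass \<delta> = (LBINT u:{0..<1}. \<delta> powr u)"

lemma borel_measurable_frac [measurable]: "(frac :: real \<Rightarrow> real) \<in> borel_measurable borel"
  unfolding frac_def by measurable

lemma nn_integral_count_space_summable:
  fixes a :: "'a \<Rightarrow> real"
  assumes "a summable_on A" "\<And>n. n \<in> A \<Longrightarrow> 0 \<le> a n"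
  shows "(\<integral>\<^sup>+n. ennreal (a n) \<partial>count_space A) = ennreal (infsum a A)"
proof -
  have "Infinite_Set_Sum.abs_summable_on a A"
    using assms by (simp flip: abs_summable_equivalent cong: summable_on_cong)
  then show ?thesis
    using assms by (simp add: nn_integral_conv_infsetsum infsetsum_infsum)
qed

lemma nn_integral_floor_frac:
  fixes F :: "int \<Rightarrow> real \<Rightarrow> ennreal"
  assumes [measurable]: "\<And>n. F n \<in> borel_measurable borel"
  shows "(\<integral>\<^sup>+x. F \<lfloor>x\<rfloor> (frac x) \<partial>lborel)
    = (\<integral>\<^sup>+n. \<integral>\<^sup>+u. F n u * indicator {0..<1} u \<partial>lborel \<partial>count_space UNIV)"
proof -
  have cell: "indicator {of_int n..<of_int n + 1} x = (indicator {\<lfloor>x\<rfloor>} n :: ennreal)"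
    for n and x :: real
    by (auto split: split_indicator simp: floor_eq_iff) linarith+
  have "(\<integral>\<^sup>+x. F \<lfloor>x\<rfloor> (frac x) \<partial>lborel)
      = (\<integral>\<^sup>+x. \<integral>\<^sup>+n. F n (x - of_int n) * indicator {of_int n..<of_int n + 1} x
          \<partial>count_space UNIV \<partial>lborel)"
    unfolding cell by (simp add: nn_integral_indicator_singleton frac_def)
  also have "\<dots> = (\<integral>\<^sup>+n. \<integral>\<^sup>+x. F n (x - of_int n) * indicator {of_int n..<of_int n + 1} x
          \<partial>lborel \<partial>count_space UNIV)"
    by (rule nn_integral_count_space_nn_integral) auto
  also have "\<dots> = (\<integral>\<^sup>+n. \<integral>\<^sup>+u. F n u * indicator {0..<1} u \<partial>lborel \<partial>count_space UNIV)"
  proof (rule nn_integral_cong)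
    fix n :: int
    have "indicator {of_int n..<of_int n + 1} (of_int n + u) = (indicator {0..<1} u :: ennreal)"
      for u :: real
      by (simp split: split_indicator)
    then show "(\<integral>\<^sup>+x. F n (x - of_int n) * indicator {of_int n..<of_int n + 1} x \<partial>lborel)
        = (\<integral>\<^sup>+u. F n u * indicator {0..<1} u \<partial>lborel)"
      by (subst nn_integral_real_affine[where c = 1 and t = "of_int n"]) auto
  qed
  finally show ?thesis .
qed

lemma set_integrable_powr_exponent:
  fixes \<delta> a b :: real
  assumes "0 < \<delta>"
  shows "set_integrable lborel {a..<b} (\<lambda>u. \<delta> powr u)"
proof (rule set_integrable_subset)
  show "set_integrable lborel {a..b} (\<lambda>u. \<delta> powr u)"
    using assms by (intro borel_integrable_atLeastAtMost') (auto intro!: continuous_intros)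
qed auto

lemma geometric_mass_pos:
  assumes "0 < \<delta>"
  shows "0 < geometric_mass \<delta>"
proof -
  have "min 1 \<delta> = (LBINT u:{0..<1::real}. min 1 \<delta>)"
    by (simp add: set_lebesgue_integral_def)
  also have "\<dots> \<le> geometric_mass \<delta>"
    unfolding geometric_mass_def
  proof (rule set_integral_mono)
    fix u :: real assume "u \<in> {0..<1}"
    then show "min 1 \<delta> \<le> \<delta> powr u"
      using assms powr_mono'[of u 1 \<delta>] ge_one_powr_ge_zero[of \<delta> u] by (cases "\<delta> \<le> 1") auto
  qed (use assms set_integrable_powr_exponent in \<open>auto simp: set_integrable_def\<close>)
  finally show ?thesis using assms by simp
qed

lemma geometric_mass_square:
  assumes "0 < \<delta>"
  shows "geometric_mass (\<delta>\<^sup>2) = (1 + \<delta>) / 2 * geometric_mass \<delta>"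
proof -
  have "\<delta> powr (2 * u) = \<delta>\<^sup>2 powr u" for u
    using assms powr_powr[of \<delta> 2 u] by simp
  then have "2 * geometric_mass (\<delta>\<^sup>2) = (LBINT v:{0..<2}. \<delta> powr v)"
    unfolding geometric_mass_def set_lebesgue_integral_def
    by (subst (2) lborel_integral_real_affine[of 2 _ 0])
      (auto simp: indicator_def intro!: Bochner_Integration.integral_cong)
  also have "{0..<2} = {0..<1} \<union> {1..<2::real}" by auto
  also have "(LBINT v:{0..<1} \<union> {1..<2}. \<delta> powr v)
      = (LBINT v:{0..<1}. \<delta> powr v) + (LBINT v:{1..<2}. \<delta> powr v)"
    using assms by (intro set_integral_Un) (auto simp: set_integrable_powr_exponent)
  also have "(LBINT v:{1..<2}. \<delta> powr v) = (LBINT u:{0..<1}. \<delta> * \<delta> powr u)"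
    unfolding set_lebesgue_integral_def using assms
    by (subst lborel_integral_real_affine[of 1 _ 1])
      (auto simp: indicator_def powr_add intro!: Bochner_Integration.integral_cong)
  finally show ?thesis by (simp add: geometric_mass_def algebra_simps)
qed

lemma geometric_extension_nonneg: "(\<And>n. 0 \<le> a n) \<Longrightarrow> 0 \<le> geometric_extension \<delta> a x"
  by (simp add: geometric_extension_def)

lemma geometric_extension_powr:
  "geometric_extension \<delta> a x powr r = geometric_extension (\<delta> powr r) (\<lambda>n. a n powr r) x"
  by (simp add: geometric_extension_def powr_mult powr_powr mult.commute)

lemma nonneg_bounded_geometric_extension:
  assumes "nonneg_bounded a" "0 < \<delta>"
  shows "nonneg_bounded (geometric_extension \<delta> a)"
proof -
  obtain M where nonneg: "0 \<le> a n" and M: "a n \<le> M" for n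
    using assms(1) by (auto simp: nonneg_bounded_def bdd_above_def)
  have "\<delta> powr u \<le> 1 + \<delta>" if "0 \<le> u" "u < 1" for u
    using assms(2) that powr_mono[of u 1 \<delta>] powr_mono'[of 0 u \<delta>] by (cases "\<delta> \<le> 1") auto
  then have "geometric_extension \<delta> a x \<le> M * (1 + \<delta>)" for x
    unfolding geometric_extension_def using M nonneg[of "\<lfloor>x\<rfloor>"] order_trans[OF nonneg M]
    by (intro mult_mono) (auto simp: frac_lt_1)
  with nonneg show ?thesis
    by (intro nonneg_boundedI geometric_extension_nonneg)
qed

lemma geometric_extension_mult_le:
  assumes "0 < \<delta>"
    and no_carry: "\<And>m n. a m * b n \<le> c (m + n)"
    and carry: "\<And>m n. \<delta> * (a m * b n) \<le> c (m + n + 1)"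
  shows "geometric_extension \<delta> a x * geometric_extension \<delta> b y \<le> geometric_extension \<delta> c (x + y)"
proof (cases "frac x + frac y < 1")
  case True
  have "geometric_extension \<delta> a x * geometric_extension \<delta> b y
      = a \<lfloor>x\<rfloor> * b \<lfloor>y\<rfloor> * \<delta> powr (frac x + frac y)"
    by (simp add: geometric_extension_def powr_add)
  also have "\<dots> \<le> c (\<lfloor>x\<rfloor> + \<lfloor>y\<rfloor>) * \<delta> powr (frac x + frac y)"
    by (intro mult_right_mono no_carry) simp
  also have "\<dots> = geometric_extension \<delta> c (x + y)"
    using True by (simp add: geometric_extension_def frac_add floor_add)
  finally show ?thesis .
next
  case False
  have "geometric_extension \<delta> a x * geometric_extension \<delta> b y
      = \<delta> * (a \<lfloor>x\<rfloor> * b \<lfloor>y\<rfloor>) * \<delta> powr (frac x + frac y - 1)"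
    using assms(1) by (simp add: geometric_extension_def powr_add powr_diff)
  also have "\<dots> \<le> c (\<lfloor>x\<rfloor> + \<lfloor>y\<rfloor> + 1) * \<delta> powr (frac x + frac y - 1)"
    by (intro mult_right_mono carry) simp
  also have "\<dots> = geometric_extension \<delta> c (x + y)"
    using False by (simp add: geometric_extension_def frac_add floor_add)
  finally show ?thesis .
qed

lemma has_bochner_integral_geometric_extension:
  assumes "a summable_on UNIV" "\<And>n. 0 \<le> a n" "0 < \<delta>"
  shows "has_bochner_integral lborel (geometric_extension \<delta> a) (infsum a UNIV * geometric_mass \<delta>)"
proof (rule has_bochner_integral_nn_integral)
  have "(\<integral>\<^sup>+u. ennreal (\<delta> powr u) * indicator {0..<1} u \<partial>lborel) = ennreal (geometric_mass \<delta>)"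
    using set_integrable_powr_exponent[OF assms(3), of 0 1]
      nn_integral_eq_integral[of lborel "\<lambda>u. indicator {0..<1::real} u * \<delta> powr u"]
    by (simp add: geometric_mass_def set_lebesgue_integral_def set_integrable_def ennreal_mult''
        ennreal_indicator mult.commute)
  then have mass: "(\<integral>\<^sup>+u. ennreal (a n * \<delta> powr u) * indicator {0..<1} u \<partial>lborel)
      = ennreal (a n) * ennreal (geometric_mass \<delta>)" for n
    using assms(2) by (simp add: ennreal_mult mult.assoc nn_integral_cmult)
  have "(\<integral>\<^sup>+x. ennreal (geometric_extension \<delta> a x) \<partial>lborel)
      = (\<integral>\<^sup>+n. ennreal (a n) * ennreal (geometric_mass \<delta>) \<partial>count_space UNIV)"
    unfolding geometric_extension_def
    by (subst nn_integral_floor_frac[where F = "\<lambda>n u. ennreal (a n * \<delta> powr u)"])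
      (simp_all add: mass)
  then show "(\<integral>\<^sup>+x. ennreal (geometric_extension \<delta> a x) \<partial>lborel)
      = ennreal (infsum a UNIV * geometric_mass \<delta>)"
    using assms geometric_mass_pos[OF assms(3)]
    by (simp add: nn_integral_multc nn_integral_count_space_summable ennreal_mult infsum_nonneg)
  show "geometric_extension \<delta> a \<in> borel_measurable lborel"
    unfolding geometric_extension_def by measurable
  show "0 \<le> infsum a UNIV * geometric_mass \<delta>"
    using assms geometric_mass_pos[of \<delta>] by (simp add: infsum_nonneg)
qed (use assms in \<open>simp add: geometric_extension_nonneg\<close>)

lemma (in conjugate_exponents) geometric_mass_square_le:
  assumes "0 < \<delta>"
  shows "geometric_mass (\<delta>\<^sup>2)
    \<le> geometric_mass (\<delta> powr p) powr (1 / p) * geometric_mass (\<delta> powr q) powr (1 / q)"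
proof -
  define v where "v u = indicator {0..<1} u * \<delta> powr u" for u :: real
  have mass: "geometric_mass r = (LBINT u. indicator {0..<1} u * r powr u)" for r
    by (simp add: geometric_mass_def set_lebesgue_integral_def)
  have integrable: "integrable lborel (\<lambda>u. indicator {0..<1::real} u * r powr u)" if "0 < r" for r
    using set_integrable_powr_exponent[OF that, of 0 1] by (simp add: set_integrable_def)
  have v_powr: "v u powr r = indicator {0..<1} u * (\<delta> powr r) powr u" if "0 < r" for u r
    using that by (auto simp: v_def powr_powr mult.commute split: split_indicator)
  have v_square: "v u * v u = indicator {0..<1} u * \<delta>\<^sup>2 powr u" for u
    using assms by (auto simp: v_def powr_mult power2_eq_square split: split_indicator)
  have "(LBINT u. v u * v u)
      \<le> (LBINT u. v u powr p) powr (1 / p) * (LBINT u. v u powr q) powr (1 / q)"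
    using assms p_pos q_pos geometric_mass_pos[of "\<delta> powr p"] geometric_mass_pos[of "\<delta> powr q"]
    by (intro integral_holder) (simp_all add: v_square v_powr integrable mass, simp_all add: v_def)
  then show ?thesis
    using p_pos q_pos by (simp add: v_square v_powr mass)
qed

section \<open>The weighted Prekopa-Leindler inequality on the integers\<close>

lemma summable_on_powr:
  fixes g :: "'a \<Rightarrow> real"
  assumes "g summable_on A" "\<And>x. x \<in> A \<Longrightarrow> 0 \<le> g x" "1 \<le> p"
  shows "(\<lambda>x. g x powr p) summable_on A"
proof (rule summable_on_comparison_test)
  show "(\<lambda>x. infsum g A powr (p - 1) * g x) summable_on A"
    using assms by (intro summable_on_cmult_right)
  fix x assume "x \<in> A"
  then have "g x \<le> infsum g A"
    using finite_sum_le_infsum[of g A "{x}"] assms by simp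
  then have "g x powr (p - 1) * g x \<le> infsum g A powr (p - 1) * g x"
    using assms \<open>x \<in> A\<close> by (intro mult_right_mono powr_mono2) auto
  then show "g x powr p \<le> infsum g A powr (p - 1) * g x"
    using assms \<open>x \<in> A\<close> by (simp add: powr_diff split: if_splits)
qed simp

lemma nonneg_bounded_summable:
  fixes g :: "'a \<Rightarrow> real"
  assumes "g summable_on UNIV" "\<And>x. 0 \<le> g x"
  shows "nonneg_bounded g"
proof -
  have "g x \<le> infsum g UNIV" for x
    using finite_sum_le_infsum[of g UNIV "{x}"] assms by simp
  with assms(2) show ?thesis by (rule nonneg_boundedI)
qed

lemma has_bochner_integral_geometric_extension_powr:
  assumes "a summable_on UNIV" "\<And>n. 0 \<le> a n" "0 < \<delta>" "1 \<le> r"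
  shows "has_bochner_integral lborel (\<lambda>x. geometric_extension \<delta> a x powr r)
    ((\<Sum>\<^sub>\<infinity>n. a n powr r) * geometric_mass (\<delta> powr r))"
  using assms unfolding geometric_extension_powr
  by (intro has_bochner_integral_geometric_extension summable_on_powr) auto

lemma root_integral_geometric_extension_powr:
  assumes "a summable_on UNIV" "\<And>n. 0 \<le> a n" "0 < \<delta>" "1 \<le> r"
  shows "(LBINT x. geometric_extension \<delta> a x powr r) powr (1 / r)
    = lp_norm r a * geometric_mass (\<delta> powr r) powr (1 / r)"
  using has_bochner_integral_integral_eq[OF has_bochner_integral_geometric_extension_powr[OF assms]]
    assms(2) by (simp add: lp_norm_def powr_mult)

lemma (in conjugate_exponents) weighted_prekopa_leindler_int_pos:
  fixes g h w :: "int \<Rightarrow> real"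
  assumes \<delta>: "0 < \<delta>"
    and g: "\<And>n. 0 \<le> g n" "g summable_on UNIV" and h: "\<And>n. 0 \<le> h n" "h summable_on UNIV"
    and w: "\<And>n. 0 \<le> w n" "w summable_on UNIV"
    and no_carry: "\<And>m n. g m * h n \<le> w (m + n)"
    and carry: "\<And>m n. \<delta> * (g m * h n) \<le> w (m + n + 1)"
  shows "p powr (1 / p) * q powr (1 / q) / 2 * (1 + \<delta>) * (lp_norm p g * lp_norm q h)
    \<le> infsum w UNIV"
proof -
  let ?C = "p powr (1 / p) * q powr (1 / q)"
  let ?G = "geometric_extension \<delta> g" and ?H = "geometric_extension \<delta> h"
    and ?W = "geometric_extension \<delta> w"
  have exponents: "1 \<le> p" "1 \<le> q" using p_gt_1 q_gt_1 by simp_all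
  have W: "has_bochner_integral lborel ?W (infsum w UNIV * geometric_mass \<delta>)"
    using \<delta> w by (intro has_bochner_integral_geometric_extension)
  have "?C * (lp_norm p g * lp_norm q h) * ((1 + \<delta>) / 2 * geometric_mass \<delta>)
      \<le> ?C * (lp_norm p g * lp_norm q h)
        * (geometric_mass (\<delta> powr p) powr (1 / p) * geometric_mass (\<delta> powr q) powr (1 / q))"
    using geometric_mass_square_le[OF \<delta>]
    by (intro mult_left_mono) (simp_all add: geometric_mass_square[OF \<delta>] lp_norm_def)
  also have "\<dots> = ?C * ((LBINT x. ?G x powr p) powr (1 / p) * (LBINT y. ?H y powr q) powr (1 / q))"
    using g h \<delta> exponents by (simp add: root_integral_geometric_extension_powr)
  also have "\<dots> \<le> (LBINT z. ?W z)"
  proof (rule prekopa_leindler_real)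
    show "nonneg_bounded ?G" "nonneg_bounded ?H"
      using g h \<delta> by (intro nonneg_bounded_geometric_extension nonneg_bounded_summable; simp)+
    show "integrable lborel (\<lambda>x. ?G x powr p)" "integrable lborel (\<lambda>y. ?H y powr q)"
      using has_bochner_integral_geometric_extension_powr g h \<delta> exponents integrable.intros
      by blast+
    show "integrable lborel ?W" using W by (rule integrable.intros)
    show "?G x * ?H y \<le> ?W (x + y)" for x y
      using \<delta> no_carry carry by (rule geometric_extension_mult_le)
  qed
  also have "\<dots> = infsum w UNIV * geometric_mass \<delta>"
    using W by (rule has_bochner_integral_integral_eq)
  finally have "?C / 2 * (1 + \<delta>) * (lp_norm p g * lp_norm q h) * geometric_mass \<delta>
      \<le> infsum w UNIV * geometric_mass \<delta>"
    by (simp add: mult_ac)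
  then show ?thesis
    using geometric_mass_pos[OF \<delta>] by simp
qed

theorem (in conjugate_exponents) weighted_prekopa_leindler_int:
  fixes g h w :: "int \<Rightarrow> real"
  assumes \<delta>: "0 \<le> \<delta>"
    and g: "\<And>n. 0 \<le> g n" "g summable_on UNIV" and h: "\<And>n. 0 \<le> h n" "h summable_on UNIV"
    and w: "\<And>n. 0 \<le> w n" "w summable_on UNIV"
    and no_carry: "\<And>m n. g m * h n \<le> w (m + n)"
    and carry: "\<And>m n. \<delta> * (g m * h n) \<le> w (m + n + 1)"
  shows "p powr (1 / p) * q powr (1 / q) / 2 * (1 + \<delta>) * (lp_norm p g * lp_norm q h)
    \<le> infsum w UNIV"
proof (cases "\<delta> = 0")
  case False
  then show ?thesis
    using assms by (intro weighted_prekopa_leindler_int_pos) auto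
next
  case True
  \<comment> \<open>Since \<open>0 powr 0 = 0\<close>, the extension by powers of \<open>\<delta>\<close> vanishes. Doubling \<open>w\<close> reduces to
    \<open>\<delta> = 1\<close>, where the bound is twice as large.\<close>
  let ?doubled = "\<lambda>n. w n + w (n - 1)"
  have shift: "bij_betw (\<lambda>n. n - 1) UNIV (UNIV :: int set)"
    by (rule bij_betwI[where g = "\<lambda>n. n + 1"]) auto
  have shifted: "(\<lambda>n. w (n - 1)) summable_on UNIV" "(\<Sum>\<^sub>\<infinity>n. w (n - 1)) = infsum w UNIV"
    using w(2) summable_on_reindex_bij_betw[OF shift, of w] infsum_reindex_bij_betw[OF shift, of w]
    by simp_all
  have "p powr (1 / p) * q powr (1 / q) / 2 * (1 + 1) * (lp_norm p g * lp_norm q h)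
      \<le> infsum ?doubled UNIV"
  proof (rule weighted_prekopa_leindler_int_pos)
    show "g m * h n \<le> w (m + n) + w (m + n - 1)" for m n
      using no_carry[of m n] w(1)[of "m + n - 1"] by simp
    show "1 * (g m * h n) \<le> w (m + n + 1) + w (m + n + 1 - 1)" for m n
      using no_carry[of m n] w(1)[of "m + n + 1"] by simp
  qed (use g h w shifted in \<open>auto intro: summable_on_add\<close>)
  also have "\<dots> = 2 * infsum w UNIV"
    using w shifted by (simp add: infsum_add)
  finally show ?thesis using True by simp
qed

section \<open>Max-convolutions and the constants \<open>\<gamma>\<^sub>p\<close>\<close>

lemma
  assumes "nonneg_bounded f" "nonneg_bounded g"
  shows mult_le_maxconv: "f s * g t \<le> maxconv f g (s + t)"
    and nonneg_bounded_maxconv: "nonneg_bounded (maxconv f g)"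
proof -
  have nonneg: "0 \<le> f x" "0 \<le> g x" for x
    using assms by (simp_all add: nonneg_bounded_def)
  obtain A B where AB: "f x \<le> A" "g x \<le> B" for x
    using assms by (auto simp: nonneg_bounded_def bdd_above_def)
  have product_le: "f u * g (x - u) \<le> A * B" for u x
    using AB nonneg order_trans[OF nonneg(1) AB(1)] by (intro mult_mono) auto
  then have le_maxconv: "f u * g (x - u) \<le> maxconv f g x" for u x
    unfolding maxconv_def by (intro cSUP_upper bdd_aboveI2) auto
  show "f s * g t \<le> maxconv f g (s + t)"
    using le_maxconv[of s "s + t"] by simp
  have "0 \<le> maxconv f g x" for x
    using nonneg le_maxconv[of 0 x] by (meson mult_nonneg_nonneg order_trans)
  moreover have "maxconv f g x \<le> A * B" for x
    unfolding maxconv_def using product_le by (intro cSUP_least) auto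
  ultimately show "nonneg_bounded (maxconv f g)"
    by (rule nonneg_boundedI)
qed

lemma maxconv_indicator_0:
  assumes "\<And>x. 0 \<le> f x"
  shows "maxconv f (indicator {0}) = f"
proof
  fix x
  show "maxconv f (indicator {0}) x = f x"
    unfolding maxconv_def
  proof (rule cSup_eq_maximum)
    show "f x \<in> range (\<lambda>t. f t * indicator {0} (x - t))"
      by (rule image_eqI[of _ _ x]) auto
  qed (use assms in \<open>auto split: split_indicator\<close>)
qed

lemma nonneg_l1_imp_nonneg_bounded: "nonneg_l1 g \<Longrightarrow> nonneg_bounded g"
  by (rule nonneg_bounded_summable) (auto simp: nonneg_l1_def)

lemma lp_norm_pos:
  assumes "nonneg_l1 g" "1 \<le> p"
  shows "0 < lp_norm p g"
proof -
  have g: "\<And>x. 0 \<le> g x" "g summable_on UNIV"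
    using assms(1) by (auto simp: nonneg_l1_def)
  obtain i where "g i \<noteq> 0" using assms(1) by (auto simp: nonneg_l1_def)
  then have "0 < \<bar>g i\<bar> powr p" by simp
  also have "\<bar>g i\<bar> powr p \<le> (\<Sum>\<^sub>\<infinity>x. \<bar>g x\<bar> powr p)"
    using finite_sum_le_infsum[of "\<lambda>x. \<bar>g x\<bar> powr p" UNIV "{i}"]
      summable_on_powr[of g UNIV p] g assms(2) by simp
  finally show ?thesis by (simp add: lp_norm_def)
qed

lemma has_sum_indicator_0: "((indicator {0} :: int \<Rightarrow> real) has_sum 1) UNIV"
  by (rule has_sum_finite_neutralI[of "{0}"]) auto

lemma nonneg_l1_indicator_0: "nonneg_l1 (indicator {0})"
proof -
  have "(indicator {0} :: int \<Rightarrow> real) \<noteq> (\<lambda>_. 0)"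
    by (auto simp: fun_eq_iff indicator_def)
  then show ?thesis
    using has_sum_imp_summable[OF has_sum_indicator_0] by (simp add: nonneg_l1_def)
qed

lemma lp_norm_indicator_0: "lp_norm p (indicator {0}) = 1"
proof -
  have "(\<lambda>x::int. \<bar>indicator {0} x\<bar> powr p) = (indicator {0} :: int \<Rightarrow> real)"
    by (auto split: split_indicator)
  then show ?thesis
    by (simp add: lp_norm_def infsumI[OF has_sum_indicator_0])
qed

definition gamma_ratios :: "real \<Rightarrow> (int \<Rightarrow> real) \<Rightarrow> real set" where
  "gamma_ratios p f = {(\<Sum>\<^sub>\<infinity>x. maxconv (maxconv f g) h x) / (lp_norm p g * lp_norm (p / (p - 1)) h)
    | g h. nonneg_l1 g \<and> nonneg_l1 h \<and> maxconv (maxconv f g) h summable_on UNIV}"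

lemma gamma_p_eq_Inf: "gamma_p p f = Inf (gamma_ratios p f)"
  by (simp add: gamma_p_def gamma_ratios_def)

lemma gamma_ratios_nonneg:
  assumes "nonneg_bounded f" "r \<in> gamma_ratios p f"
  shows "0 \<le> r"
proof -
  obtain g h where "nonneg_l1 g" "nonneg_l1 h"
    and r: "r = (\<Sum>\<^sub>\<infinity>x. maxconv (maxconv f g) h x) / (lp_norm p g * lp_norm (p / (p - 1)) h)"
    using assms(2) by (auto simp: gamma_ratios_def)
  then have "nonneg_bounded (maxconv (maxconv f g) h)"
    by (intro nonneg_bounded_maxconv nonneg_l1_imp_nonneg_bounded assms(1))
  then show ?thesis
    unfolding r nonneg_bounded_def lp_norm_def
    by (intro divide_nonneg_nonneg infsum_nonneg mult_nonneg_nonneg) auto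
qed

lemma infsum_in_gamma_ratios:
  assumes "nonneg_l1 f"
  shows "infsum f UNIV \<in> gamma_ratios p f"
proof -
  have "maxconv (maxconv f (indicator {0})) (indicator {0}) = f" "f summable_on UNIV"
    using assms by (simp_all add: nonneg_l1_def maxconv_indicator_0)
  then show ?thesis
    unfolding gamma_ratios_def
    by (intro CollectI exI[of _ "indicator {0}"])
      (simp add: nonneg_l1_indicator_0 lp_norm_indicator_0)
qed

lemma gamma_p_le_infsum:
  assumes "nonneg_l1 f"
  shows "gamma_p p f \<le> infsum f UNIV"
  unfolding gamma_p_eq_Inf
proof (rule cInf_lower)
  show "bdd_below (gamma_ratios p f)"
    using gamma_ratios_nonneg[OF nonneg_l1_imp_nonneg_bounded[OF assms]] by (rule bdd_belowI)
qed (rule infsum_in_gamma_ratios[OF assms])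

lemma (in conjugate_exponents) le_gamma_pI:
  assumes "nonneg_l1 f"
    and bound: "\<And>g h. nonneg_l1 g \<Longrightarrow> nonneg_l1 h \<Longrightarrow> maxconv (maxconv f g) h summable_on UNIV \<Longrightarrow>
      c * (lp_norm p g * lp_norm q h) \<le> infsum (maxconv (maxconv f g) h) UNIV"
  shows "c \<le> gamma_p p f"
  unfolding gamma_p_eq_Inf
proof (rule cInf_greatest)
  show "gamma_ratios p f \<noteq> {}" using infsum_in_gamma_ratios[OF assms(1)] by blast
  fix r assume "r \<in> gamma_ratios p f"
  then obtain g h where gh: "nonneg_l1 g" "nonneg_l1 h" "maxconv (maxconv f g) h summable_on UNIV"
    and r: "r = infsum (maxconv (maxconv f g) h) UNIV / (lp_norm p g * lp_norm q h)"
    by (auto simp: gamma_ratios_def conjugate_eq)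
  have "0 < lp_norm p g * lp_norm q h"
    using gh p_gt_1 q_gt_1 by (intro mult_pos_pos lp_norm_pos) auto
  then show "c \<le> r"
    using bound[OF gh] by (simp add: r pos_le_divide_eq)
qed

definition two_point :: "real \<Rightarrow> int \<Rightarrow> real" where
  "two_point \<delta> x = (if x = 0 then 1 else 0) + \<delta> * (if x = 1 then 1 else 0)"

lemma has_sum_two_point: "(two_point \<delta> has_sum (1 + \<delta>)) UNIV"
  by (rule has_sum_finite_neutralI[of "{0, 1}"]) (auto simp: two_point_def)

lemma nonneg_l1_two_point:
  assumes "0 \<le> \<delta>"
  shows "nonneg_l1 (two_point \<delta>)"
proof -
  have "two_point \<delta> \<noteq> (\<lambda>_. 0)"
    by (auto simp: two_point_def fun_eq_iff intro: exI[of _ 0])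
  moreover have "0 \<le> two_point \<delta> x" for x
    using assms by (simp add: two_point_def)
  ultimately show ?thesis
    using has_sum_imp_summable[OF has_sum_two_point] by (auto simp: nonneg_l1_def)
qed

theorem (in conjugate_exponents) le_gamma_p_two_point:
  assumes "0 \<le> \<delta>"
  shows "p powr (1 / p) * q powr (1 / q) / 2 * (1 + \<delta>) \<le> gamma_p p (two_point \<delta>)"
proof (rule le_gamma_pI[OF nonneg_l1_two_point[OF assms]])
  fix g h :: "int \<Rightarrow> real"
  let ?w = "maxconv (maxconv (two_point \<delta>) g) h"
  assume gh: "nonneg_l1 g" "nonneg_l1 h" and w: "?w summable_on UNIV"
  note bounded = nonneg_l1_imp_nonneg_bounded[OF nonneg_l1_two_point[OF assms]]
    gh[THEN nonneg_l1_imp_nonneg_bounded]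
  note fg_bounded = nonneg_bounded_maxconv[OF bounded(1,2)]
  have triple_product_le: "two_point \<delta> s * (g m * h n) \<le> ?w (m + n + s)" for s m n
  proof -
    have "two_point \<delta> s * (g m * h n) = two_point \<delta> s * g m * h n" by simp
    also have "\<dots> \<le> maxconv (two_point \<delta>) g (s + m) * h n"
      using mult_le_maxconv[OF bounded(1,2)] gh(2)
      by (intro mult_right_mono) (auto simp: nonneg_l1_def)
    also have "\<dots> \<le> ?w (s + m + n)"
      by (rule mult_le_maxconv[OF fg_bounded bounded(3)])
    finally show ?thesis by (simp add: ac_simps)
  qed
  show "p powr (1 / p) * q powr (1 / q) / 2 * (1 + \<delta>) * (lp_norm p g * lp_norm q h)
    \<le> infsum ?w UNIV"
  proof (rule weighted_prekopa_leindler_int)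
    show "g m * h n \<le> ?w (m + n)" for m n
      using triple_product_le[of 0 m n] by (simp add: two_point_def)
    show "\<delta> * (g m * h n) \<le> ?w (m + n + 1)" for m n
      using triple_product_le[of 1 m n] by (simp add: two_point_def)
    show "0 \<le> ?w n" for n
      using nonneg_bounded_maxconv[OF fg_bounded bounded(3)] by (simp add: nonneg_bounded_def)
  qed (use assms gh w in \<open>auto simp: nonneg_l1_def\<close>)
qed

theorem mainTheorem14:
  fixes \<delta> :: real
  assumes "0 \<le> \<delta>" "\<delta> \<le> 1"
  defines "f \<equiv> (\<lambda>x::int. (if x = 0 then 1 else 0) + \<delta> * (if x = 1 then 1 else 0))"
  shows "gamma f = 1 + \<delta> \<and>
         (\<forall>p q. 1 < p \<longrightarrow> q = p / (p - 1) \<longrightarrow>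
           gamma_p p f \<ge> p powr (1 / p) * q powr (1 / q) / 2 * (1 + \<delta>))"
proof -
  have f: "f = two_point \<delta>" by (simp add: f_def two_point_def fun_eq_iff)
  have lower: "p powr (1 / p) * q powr (1 / q) / 2 * (1 + \<delta>) \<le> gamma_p p f"
    if "1 < p" "q = p / (p - 1)" for p q
  proof -
    interpret conjugate_exponents p q
      unfolding that(2) using that(1) by unfold_locales (simp_all add: divide_simps)
    show ?thesis unfolding f using assms(1) by (rule le_gamma_p_two_point)
  qed
  have "1 + \<delta> \<le> gamma f"
    using lower[of 2 2] by (simp add: gamma_def powr_half_sqrt)
  moreover have "gamma f \<le> 1 + \<delta>"
    using gamma_p_le_infsum[OF nonneg_l1_two_point[OF assms(1)]]
    by (simp add: gamma_def f infsumI[OF has_sum_two_point])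
  ultimately show ?thesis using lower by auto
qed

end
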